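(* Let $(V,E,<)$ be a nonempty wellordered connected graph, and let $q_\alpha$ ($\alpha<\Gamma$) be the vertices produced by deterministic breadth-first search on it, where $\Gamma$ is the closure ordinal. Then the ordering $\prec$ of $V$ induced by $\alpha\mapsto q_\alpha$ (i.e., $q_\alpha\prec q_\beta$ iff $\alpha<\beta$) is a breadth-first traversal of $(V,E)$.
   Context: A wellordered connected graph $(V,E,<)$ is a connected undirected graph $(V,E)$ (possibly infinite) together with a wellordering $<$ of $V$. A wellordered traversal of $(V,E)$ is a wellordering of $V$ all of whose initial segments induce connected subgraphs. Given a wellordered traversal $\prec$, its least neighbor function $p$ takes each vertex other than the minimum to its $\prec$-least neighbor; $\prec$ is breadth-first if $p$ is weakly monotone: $v\preceq w$ implies $p(v)\preceq p(w)$ for all non-minimal $v,w$. Deterministic breadth-first search on $(V,E,<)$: define sets $B_\alpha$ and sequences $Q_\alpha$ (regarded both as sequences and as sets) by transfinite recursion, where $q_\alpha$ denotes the first element of $Q_\alpha\setminus B_\alpha$ whenever that is nonempty. $B_0=\emptyset$ and $Q_0=(v_0)$, where $v_0$ is the $<$-least element of $V$. If $Q_\alpha\setminus B_\alpha\neq\emptyset$, then $B_{\alpha+1}=B_\alpha\cup\{q_\alpha\}$ and $Q_{\alpha+1}$ is obtained from $Q_\alpha$ by appending at the end, in $<$-order, all neighbors of $q_\alpha$ not in $Q_\alpha$; otherwise $B_{\alpha+1}=B_\alpha$ and $Q_{\alpha+1}=Q_\alpha$. At limit $\alpha$, $B_\alpha=\bigcup_{\beta<\alpha}B_\beta$ and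 $Q_\alpha=\bigcup_{\beta<\alpha}Q_\beta$ (each later sequence end-extends the earlier ones). The closure ordinal $\Gamma$ is the least ordinal with $B_\Gamma=B_{\Gamma+1}$. One has $B_\Gamma=V$, so $\alpha\mapsto q_\alpha$ is a bijection from $\Gamma$ to $V$. *)

theory Defs
  imports Main
begin

section \<open>Ordinals\<close>

text \<open>
  HOL has no type of all ordinals. The elements of \<open>'a ordinal\<close> are the ordinals below the
  initial ordinal of the cardinal \<open>2^(aleph_0 + |'a|)\<close>, realised as the well-order that the
  library chooses on \<open>(nat + 'a) set\<close>. This is a limit ordinal of cardinality greater than
  that of \<open>'a\<close>, hence long enough for any strictly increasing transfinite sequence of
  subsets of \<open>'a\<close> to become stationary (see \<open>less_osucc\<close> and \<open>no_inj_ordinal\<close> below).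
\<close>

typedef 'a ordinal = "UNIV :: (nat + 'a) set set"
  by simp

instantiation ordinal :: (type) wellorder
begin

definition less_eq_ordinal :: "'a ordinal \<Rightarrow> 'a ordinal \<Rightarrow> bool" where
  "\<alpha> \<le> \<beta> \<longleftrightarrow> (Rep_ordinal \<alpha>, Rep_ordinal \<beta>) \<in> card_of (UNIV :: (nat + 'a) set set)"

definition less_ordinal :: "'a ordinal \<Rightarrow> 'a ordinal \<Rightarrow> bool" where
  "\<alpha> < \<beta> \<longleftrightarrow> \<alpha> \<le> \<beta> \<and> \<not> \<beta> \<le> (\<alpha> :: 'a ordinal)"

instance
proof -
  let ?r = "card_of (UNIV :: (nat + 'a) set set)"
  have wo: "well_order_on UNIV ?r"
    by (rule card_of_well_order_on)
  then have lin: "refl ?r" "trans ?r" "antisym ?r" "total ?r"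
    by (auto simp: well_order_on_def linear_order_on_def partial_order_on_def preorder_on_def)
  show "OFCLASS('a ordinal, wellorder_class)"
  proof (standard, goal_cases)
    case 1
    then show ?case by (simp add: less_ordinal_def)
  next
    case 2
    then show ?case using lin(1) by (simp add: less_eq_ordinal_def refl_on_def)
  next
    case 3
    then show ?case using lin(2) by (auto simp: less_eq_ordinal_def elim: transD)
  next
    case 4
    then show ?case using lin(3)
      by (auto simp: less_eq_ordinal_def Rep_ordinal_inject dest: antisymD)
  next
    case (5 \<alpha> \<beta>)
    then show ?case using lin(1,4)
      by (cases "\<alpha> = \<beta>")
        (auto simp: less_eq_ordinal_def total_on_def refl_on_def Rep_ordinal_inject)
  next
    case (6 P \<alpha>)
    have "{(\<alpha>, \<beta>). \<alpha> < (\<beta> :: 'a ordinal)} \<subseteq> inv_image (?r - Id) Rep_ordinal"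
      using lin(1) by (auto simp: inv_image_def less_ordinal_def less_eq_ordinal_def Rep_ordinal_inject)
    moreover have "wf (?r - Id)"
      using wo by (simp add: well_order_on_def)
    ultimately have "wf {(\<alpha>, \<beta>). \<alpha> < (\<beta> :: 'a ordinal)}"
      using wf_subset wf_inv_image by blast
    then show ?case
      using 6 by (induction \<alpha> rule: wf_induct_rule) auto
  qed
qed

end

definition ozero :: "'a ordinal" where
  "ozero = (LEAST \<alpha>. True)"

definition osucc :: "'a ordinal \<Rightarrow> 'a ordinal" where
  "osucc \<alpha> = (LEAST \<beta>. \<alpha> < \<beta>)"

definition is_limit :: "'a ordinal \<Rightarrow> bool" where
  "is_limit \<alpha> \<longleftrightarrow> \<alpha> \<noteq> ozero \<and> (\<nexists>\<beta>. \<alpha> = osucc \<beta>)"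

lemma less_osucc: "(\<alpha> :: 'a ordinal) < osucc \<alpha>"
proof -
  let ?r = "card_of (UNIV :: (nat + 'a) set set)"
  have inf: "infinite (Field ?r)"
    by (simp add: Field_card_of Finite_Set.finite_set finite_Plus_UNIV_iff)
  obtain b where "Rep_ordinal \<alpha> \<noteq> b" "(Rep_ordinal \<alpha>, b) \<in> ?r"
    using infinite_Card_order_limit[OF card_of_Card_order inf, of "Rep_ordinal \<alpha>"] by (auto simp: Field_card_of)
  then have "\<alpha> \<le> Abs_ordinal b" "\<alpha> \<noteq> Abs_ordinal b"
    by (auto simp: less_eq_ordinal_def Abs_ordinal_inverse)
  then have "\<alpha> < Abs_ordinal b"
    by simp
  then show ?thesis
    unfolding osucc_def by (rule LeastI)
qed

lemma osucc_le_iff: "osucc \<alpha> \<le> \<beta> \<longleftrightarrow> \<alpha> < \<beta>"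
  using less_osucc[of \<alpha>] by (auto simp: osucc_def intro: Least_le)

lemma osucc_inject [simp]: "osucc \<alpha> = osucc \<beta> \<longleftrightarrow> \<alpha> = \<beta>"
  by (metis less_osucc osucc_le_iff linorder_less_linear not_le)

lemma ozero_le [simp]: "ozero \<le> \<alpha>"
  by (simp add: ozero_def Least_le)

lemma osucc_neq_ozero [simp]: "osucc \<alpha> \<noteq> ozero"
  by (metis less_osucc ozero_le not_le)

lemma no_inj_ordinal: "\<not> inj (f :: 'a ordinal \<Rightarrow> 'a)"
proof
  assume "inj f"
  define g :: "'a set \<Rightarrow> 'a" where "g A = f (Abs_ordinal (Inr ` A))" for A
  have "inj g"
    by (rule injI) (simp add: g_def inj_eq[OF \<open>inj f\<close>] Abs_ordinal_inject inj_image_eq_iff)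
  then have "surj (inv g)"
    by (rule inj_imp_surj_inv)
  then show False
    by (metis Cantors_theorem Pow_UNIV)
qed


section \<open>Wellorderings, connected graphs and traversals\<close>

text \<open>
  Vertex orderings are strict, as the symbols \<open><\<close> and \<open>\<prec>\<close> suggest. Well-foundedness includes
  irreflexivity.
\<close>

definition wellordering_on :: "'a set \<Rightarrow> 'a rel \<Rightarrow> bool" where
  "wellordering_on V R \<longleftrightarrow> R \<subseteq> V \<times> V \<and> trans R \<and> total_on V R \<and> wf R"

text \<open>Usable for strict and for reflexive orderings \<open>R\<close>.\<close>

definition least_elem :: "'a rel \<Rightarrow> 'a set \<Rightarrow> 'a" where
  "least_elem R S = (THE x. x \<in> S \<and> (\<forall>y\<in>S. x = y \<or> (x, y) \<in> R))"

text \<open>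
  An undirected graph is a vertex set with a symmetric adjacency relation. Loops are not excluded;
  they influence neither connectedness nor the search. The empty graph counts as connected.
\<close>

definition undirected_graph :: "'a set \<Rightarrow> 'a rel \<Rightarrow> bool" where
  "undirected_graph V E \<longleftrightarrow> E \<subseteq> V \<times> V \<and> sym E"

definition neighbors :: "'a rel \<Rightarrow> 'a \<Rightarrow> 'a set" where
  "neighbors E v = {u. (v, u) \<in> E}"

definition induces_connected :: "'a rel \<Rightarrow> 'a set \<Rightarrow> bool" where
  "induces_connected E S \<longleftrightarrow> (\<forall>u\<in>S. \<forall>v\<in>S. (u, v) \<in> (E \<inter> S \<times> S)\<^sup>*)"

definition wellordered_connected_graph :: "'a set \<Rightarrow> 'a rel \<Rightarrow> 'a rel \<Rightarrow> bool" where
  "wellordered_connected_graph V E L \<longleftrightarrow>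
     undirected_graph V E \<and> induces_connected E V \<and> wellordering_on V L"

definition initial_segment :: "'a set \<Rightarrow> 'a rel \<Rightarrow> 'a set \<Rightarrow> bool" where
  "initial_segment V R S \<longleftrightarrow> S \<subseteq> V \<and> (\<forall>v\<in>S. \<forall>u\<in>V. (u, v) \<in> R \<longrightarrow> u \<in> S)"

definition wellordered_traversal :: "'a set \<Rightarrow> 'a rel \<Rightarrow> 'a rel \<Rightarrow> bool" where
  "wellordered_traversal V E R \<longleftrightarrow>
     wellordering_on V R \<and> (\<forall>S. initial_segment V R S \<longrightarrow> induces_connected E S)"

definition least_neighbor :: "'a rel \<Rightarrow> 'a rel \<Rightarrow> 'a \<Rightarrow> 'a" where
  "least_neighbor E R v = least_elem R (neighbors E v)"

definition breadth_first_traversal :: "'a set \<Rightarrow> 'a rel \<Rightarrow> 'a rel \<Rightarrow> bool" where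
  "breadth_first_traversal V E R \<longleftrightarrow>
     wellordered_traversal V E R \<and>
     (\<forall>v \<in> V - {least_elem R V}. \<forall>w \<in> V - {least_elem R V}.
        (v, w) \<in> R\<^sup>= \<longrightarrow> (least_neighbor E R v, least_neighbor E R w) \<in> R\<^sup>=)"


section \<open>Deterministic breadth-first search\<close>

text \<open>
  The sequences \<open>Q\<^sub>\<alpha>\<close> never repeat an entry. Such a sequence is represented by the reflexive
  ordering of its entries by position, so that \<open>Field Q\<close> is the set of entries, also for sequences
  of length one, and the union of end-extending sequences is the union of relations.
\<close>

definition append_in_order :: "'a rel \<Rightarrow> 'a rel \<Rightarrow> 'a set \<Rightarrow> 'a rel" where
  "append_in_order L Q N =
     Q \<union> Field Q \<times> N \<union> {(u, w). u \<in> N \<and> w \<in> N \<and> (u, w) \<in> L\<^sup>=}"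

definition next_vertex :: "'a set \<times> 'a rel \<Rightarrow> 'a" where
  "next_vertex = (\<lambda>(B, Q). least_elem Q (Field Q - B))"

definition bfs_step :: "'a rel \<Rightarrow> 'a rel \<Rightarrow> 'a set \<times> 'a rel \<Rightarrow> 'a set \<times> 'a rel" where
  "bfs_step E L = (\<lambda>(B, Q).
     if Field Q - B \<noteq> {}
     then let q = next_vertex (B, Q)
          in (B \<union> {q}, append_in_order L Q (neighbors E q - Field Q))
     else (B, Q))"

function bfs :: "'a set \<Rightarrow> 'a rel \<Rightarrow> 'a rel \<Rightarrow> 'a ordinal \<Rightarrow> 'a set \<times> 'a rel" where
  "bfs V E L \<alpha> =
     (if \<alpha> = ozero then ({}, {(least_elem L V, least_elem L V)})
      else if is_limit \<alpha>
      then (\<Union>\<beta>\<in>{..<\<alpha>}. fst (bfs V E L \<beta>), \<Union>\<beta>\<in>{..<\<alpha>}. snd (bfs V E L \<beta>))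
      else bfs_step E L (bfs V E L (THE \<beta>. \<alpha> = osucc \<beta>)))"
  by pat_completeness auto
termination
proof (relation "inv_image {(\<alpha>, \<beta>). \<alpha> < \<beta>} (\<lambda>(V, E, L, \<alpha>). \<alpha>)", goal_cases)
  case 1
  show ?case by (intro wf_inv_image wf)
qed (auto simp: is_limit_def less_osucc)

declare bfs.simps [simp del]

definition bfs_B :: "'a set \<Rightarrow> 'a rel \<Rightarrow> 'a rel \<Rightarrow> 'a ordinal \<Rightarrow> 'a set" where
  "bfs_B V E L \<alpha> = fst (bfs V E L \<alpha>)"

definition bfs_Q :: "'a set \<Rightarrow> 'a rel \<Rightarrow> 'a rel \<Rightarrow> 'a ordinal \<Rightarrow> 'a rel" where
  "bfs_Q V E L \<alpha> = snd (bfs V E L \<alpha>)"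

definition bfs_q :: "'a set \<Rightarrow> 'a rel \<Rightarrow> 'a rel \<Rightarrow> 'a ordinal \<Rightarrow> 'a" where
  "bfs_q V E L \<alpha> = least_elem (bfs_Q V E L \<alpha>) (Field (bfs_Q V E L \<alpha>) - bfs_B V E L \<alpha>)"

lemma bfs_ozero:
  "bfs_B V E L ozero = {}"
  "bfs_Q V E L ozero = {(least_elem L V, least_elem L V)}"
  by (simp_all add: bfs_B_def bfs_Q_def bfs.simps)

lemma bfs_osucc:
  assumes "Field (bfs_Q V E L \<alpha>) - bfs_B V E L \<alpha> \<noteq> {}"
  shows "bfs_B V E L (osucc \<alpha>) = bfs_B V E L \<alpha> \<union> {bfs_q V E L \<alpha>}"
    and "bfs_Q V E L (osucc \<alpha>) =
      append_in_order L (bfs_Q V E L \<alpha>)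
        (neighbors E (bfs_q V E L \<alpha>) - Field (bfs_Q V E L \<alpha>))"
  using assms
  by (cases "bfs V E L \<alpha>"; simp add: bfs_B_def bfs_Q_def bfs_q_def bfs.simps[of V E L "osucc \<alpha>"] is_limit_def
      bfs_step_def next_vertex_def Let_def)+

lemma bfs_osucc_idle:
  assumes "Field (bfs_Q V E L \<alpha>) - bfs_B V E L \<alpha> = {}"
  shows "bfs_B V E L (osucc \<alpha>) = bfs_B V E L \<alpha>"
    and "bfs_Q V E L (osucc \<alpha>) = bfs_Q V E L \<alpha>"
  using assms
  by (cases "bfs V E L \<alpha>"; simp add: bfs_B_def bfs_Q_def bfs.simps[of V E L "osucc \<alpha>"] is_limit_def
      bfs_step_def)+

lemma bfs_limit:
  assumes "is_limit \<alpha>"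
  shows "bfs_B V E L \<alpha> = (\<Union>\<beta>\<in>{..<\<alpha>}. bfs_B V E L \<beta>)"
    and "bfs_Q V E L \<alpha> = (\<Union>\<beta>\<in>{..<\<alpha>}. bfs_Q V E L \<beta>)"
  using assms by (simp_all add: bfs_B_def bfs_Q_def bfs.simps[of V E L \<alpha>] is_limit_def)

definition closure_ordinal :: "'a set \<Rightarrow> 'a rel \<Rightarrow> 'a rel \<Rightarrow> 'a ordinal" where
  "closure_ordinal V E L = (LEAST \<alpha>. bfs_B V E L \<alpha> = bfs_B V E L (osucc \<alpha>))"

definition bfs_ordering :: "'a set \<Rightarrow> 'a rel \<Rightarrow> 'a rel \<Rightarrow> 'a rel" where
  "bfs_ordering V E L =
     {(bfs_q V E L \<alpha>, bfs_q V E L \<beta>) | \<alpha> \<beta>. \<alpha> < \<beta> \<and> \<beta> < closure_ordinal V E L}"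

end

theory Submission
  imports Defs
begin

text \<open>
  The queues \<open>Q\<^sub>\<alpha>\<close> form a chain of well-orders, each an initial segment of all later ones, and a
  vertex is taken from the queue in the order in which it was put in. Hence \<open>\<prec>\<close> is nothing but the
  strict part of the final queue \<open>Q\<^sub>\<Gamma>\<close> (\<open>bfs_ordering_eq\<close>). This identification gives
  well-orderedness at once, and reduces every comparison \<open>v \<prec> w\<close> to the question of which of
  \<open>v\<close> and \<open>w\<close> enters the queue first.

  The second ingredient is that, for \<open>\<alpha> \<le> \<Gamma>\<close>, a vertex other than the root \<open>v\<^sub>0\<close> lies in \<open>Q\<^sub>\<alpha>\<close> iff it has a neighbor
  \<open>q\<^sub>\<beta>\<close> with \<open>\<beta> < \<alpha>\<close> (\<open>queued_iff\<close>). Three conclusions follow.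
  Since \<open>Q\<^sub>\<Gamma>\<close> is exhausted, it is closed under neighbors, so connectedness makes it all of \<open>V\<close>.
  Since \<open>q\<^sub>\<alpha>\<close> lies in \<open>Q\<^sub>\<alpha>\<close>, every \<open>q\<^sub>\<alpha> \<noteq> v\<^sub>0\<close> has a \<open>\<prec>\<close>-smaller neighbor, so that
  within any initial segment one can descend to \<open>v\<^sub>0\<close> along edges; initial segments are thus connected.
  Finally, the \<open>\<prec>\<close>-least neighbor \<open>p(v)\<close> of \<open>v \<noteq> v\<^sub>0\<close> is \<open>q\<^sub>\<alpha>\<close> for the stage \<open>\<alpha>\<close> whose
  step puts \<open>v\<close> into the queue. So if \<open>p(w) \<prec> p(v)\<close>, then \<open>w\<close> was in the queue strictly before \<open>v\<close>, whence \<open>w \<prec> v\<close>; this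
  is the contrapositive of monotonicity.
\<close>

section \<open>Ordinals\<close>

lemma less_osucc_iff: "\<beta> < osucc \<alpha> \<longleftrightarrow> \<beta> \<le> \<alpha>"
  by (meson osucc_le_iff not_le)

lemma not_less_ozero [simp]: "\<not> \<alpha> < ozero"
  by (simp add: not_less)

lemma is_limit_osucc_less:
  assumes "is_limit \<alpha>" "\<beta> < \<alpha>"
  shows "osucc \<beta> < \<alpha>"
  using assms by (metis is_limit_def osucc_le_iff order_le_less)

lemma stages_below_limit:
  assumes "is_limit \<alpha>"
  shows "(\<Union>\<gamma>\<in>{..<\<alpha>}. {\<beta>. \<beta> < \<gamma> \<and> P \<beta>}) = {\<beta>. \<beta> < \<alpha> \<and> P \<beta>}"
proof (intro equalityI subsetI)
  fix \<beta> assume "\<beta> \<in> {\<beta>. \<beta> < \<alpha> \<and> P \<beta>}"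
  then have "osucc \<beta> \<in> {..<\<alpha>}" "\<beta> \<in> {\<beta>'. \<beta>' < osucc \<beta> \<and> P \<beta>'}"
    using is_limit_osucc_less[OF assms] less_osucc by auto
  then show "\<beta> \<in> (\<Union>\<gamma>\<in>{..<\<alpha>}. {\<beta>. \<beta> < \<gamma> \<and> P \<beta>})" by blast
qed auto

lemma ordinal_induct [case_names zero succ limit]:
  assumes zero: "P ozero"
    and succ: "\<And>\<beta>. P \<beta> \<Longrightarrow> P (osucc \<beta>)"
    and limit: "\<And>\<beta>. is_limit \<beta> \<Longrightarrow> (\<And>\<gamma>. \<gamma> < \<beta> \<Longrightarrow> P \<gamma>) \<Longrightarrow> P \<beta>"
  shows "P (\<alpha> :: 'a ordinal)"
proof (induction \<alpha> rule: less_induct)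
  case (less \<alpha>)
  consider "\<alpha> = ozero" | \<beta> where "\<alpha> = osucc \<beta>" | "is_limit \<alpha>"
    unfolding is_limit_def by blast
  then show ?case
  proof cases
    case 2
    then show ?thesis
      using succ[OF less[of \<beta>]] less_osucc[of \<beta>] by simp
  qed (use zero limit less in auto)
qed


section \<open>Well-orders and end-extensions\<close>

lemma least_elem_eqI:
  assumes "antisym R" "x \<in> S" "\<And>y. y \<in> S \<Longrightarrow> x = y \<or> (x, y) \<in> R"
  shows "least_elem R S = x"
  unfolding least_elem_def
  using assms by (intro the_equality) (auto dest: antisymD)

lemma least_elem_least:
  assumes "antisym R" "total_on S R" "wf (R - Id)" "S \<noteq> {}"
  shows "least_elem R S \<in> S" "\<And>y. y \<in> S \<Longrightarrow> least_elem R S = y \<or> (least_elem R S, y) \<in> R"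
proof -
  obtain x where x: "x \<in> S" "\<And>y. (y, x) \<in> R - Id \<Longrightarrow> y \<notin> S"
    using assms(3,4) by (metis wfE_min ex_in_conv)
  have le: "x = y \<or> (x, y) \<in> R" if "y \<in> S" for y
    using x that assms(2) unfolding total_on_def by blast
  have "least_elem R S = x"
    using assms(1) x(1) le by (rule least_elem_eqI)
  then show "least_elem R S \<in> S"
    and "\<And>y. y \<in> S \<Longrightarrow> least_elem R S = y \<or> (least_elem R S, y) \<in> R"
    using x(1) le by auto
qed

lemma Well_orderD:
  assumes "Well_order r"
  shows "Refl r" "trans r" "antisym r" "Total r" "wf (r - Id)"
  using assms by (simp_all add: order_on_defs)

lemma Well_orderI:
  assumes "Refl r" "trans r" "antisym r" "Total r" "wf (r - Id)"
  shows "Well_order r"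
proof -
  have "r \<subseteq> Field r \<times> Field r"
    by (auto simp: Field_def)
  then show ?thesis
    using assms by (simp add: order_on_defs)
qed

lemma antisym_wellordering_on:
  assumes "wellordering_on V R"
  shows "antisym R"
  using assms by (auto simp: wellordering_on_def intro: antisym_on_if_asym_on wf_imp_asym)

lemma Field_append_in_order: "Field (append_in_order L Q N) = Field Q \<union> N"
  by (auto simp: append_in_order_def Field_def)

lemma append_in_order_end_extends:
  assumes "N \<inter> Field Q = {}"
  shows "(Q, append_in_order L Q N) \<in> init_seg_of"
  using assms by (auto simp: init_seg_of_def append_in_order_def Field_def)

lemma Well_order_append_in_order:
  assumes Q: "Well_order Q" and L: "wellordering_on V L" and N: "N \<subseteq> V" "N \<inter> Field Q = {}"
  shows "Well_order (append_in_order L Q N)"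
proof (rule Well_orderI)
  let ?A = "append_in_order L Q N"
  note Q = Well_orderD[OF Q]
  have L': "trans L" "total_on V L" "wf L" "antisym L"
    using L antisym_wellordering_on[OF L] by (auto simp: wellordering_on_def)
  show "Refl ?A"
    using Q(1) by (auto simp: refl_on_def Field_append_in_order) (auto simp: append_in_order_def)
  show "trans ?A"
  proof (rule transI)
    fix x y z
    assume "(x, y) \<in> ?A" "(y, z) \<in> ?A"
    then consider "(x, y) \<in> Q" "(y, z) \<in> Q" | "x \<in> Field Q" "z \<in> N"
      | "x \<in> N" "y \<in> N" "z \<in> N" "(x, y) \<in> L\<^sup>=" "(y, z) \<in> L\<^sup>="
      using N(2) by (auto simp: append_in_order_def Field_def)
    then show "(x, z) \<in> ?A"
      using transD[OF Q(2), of x y z] transD[OF L'(1), of x y z]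
      by cases (auto simp: append_in_order_def)
  qed
  show "antisym ?A"
  proof (rule antisymI)
    fix x y
    assume "(x, y) \<in> ?A" "(y, x) \<in> ?A"
    then consider "(x, y) \<in> Q" "(y, x) \<in> Q" | "(x, y) \<in> L\<^sup>=" "(y, x) \<in> L\<^sup>="
      using N(2) by (auto simp: append_in_order_def Field_def)
    then show "x = y"
      using antisymD[OF Q(3), of x y] antisymD[OF L'(4), of x y] by cases auto
  qed
  show "Total ?A"
    unfolding total_on_def Field_append_in_order
  proof (intro ballI impI)
    fix x y
    assume "x \<in> Field Q \<union> N" "y \<in> Field Q \<union> N" "x \<noteq> y"
    moreover have "(x, y) \<in> L \<or> (y, x) \<in> L" if "x \<in> N" "y \<in> N" "x \<noteq> y"
      using that L'(2) N(1) unfolding total_on_def by blast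
    moreover have "(x, y) \<in> Q \<or> (y, x) \<in> Q" if "x \<in> Field Q" "y \<in> Field Q" "x \<noteq> y"
      using that Q(4) unfolding total_on_def by blast
    ultimately show "(x, y) \<in> ?A \<or> (y, x) \<in> ?A"
      by (auto simp: append_in_order_def)
  qed
  show "wf (?A - Id)"
  proof (rule wfI_min)
    fix x and M :: "'a set"
    assume "x \<in> M"
    \<comment> \<open>A minimum is sought first among the old entries, which precede all new ones.\<close>
    show "\<exists>z\<in>M. \<forall>y. (y, z) \<in> ?A - Id \<longrightarrow> y \<notin> M"
    proof (cases "M \<inter> Field Q = {}")
      case False
      then obtain z where z: "z \<in> M \<inter> Field Q" "\<And>y. (y, z) \<in> Q - Id \<Longrightarrow> y \<notin> M \<inter> Field Q"
        using Q(5) by (metis wfE_min ex_in_conv)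
      have "y \<notin> M" if "(y, z) \<in> ?A - Id" for y
      proof -
        have "(y, z) \<in> Q - Id"
          using that z(1) N(2) by (auto simp: append_in_order_def)
        then show ?thesis
          using z(2)[of y] FieldI1[of y z Q] by auto
      qed
      with z(1) show ?thesis by blast
    next
      case True
      obtain z where z: "z \<in> M" "\<And>y. (y, z) \<in> L \<Longrightarrow> y \<notin> M"
        using L'(3) \<open>x \<in> M\<close> by (metis wfE_min)
      have "y \<notin> M" if "(y, z) \<in> ?A - Id" for y
        using that z True FieldI1[of y z Q] by (auto simp: append_in_order_def)
      with z(1) show ?thesis by blast
    qed
  qed
qed

lemma Well_order_Union_end_extensions:
  assumes chain: "R \<in> Chains init_seg_of" and wo: "\<And>r. r \<in> R \<Longrightarrow> Well_order r"
  shows "Well_order (\<Union>R)"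
proof (rule Well_orderI)
  have sub: "chain\<^sub>\<subseteq> R"
    using chain by (auto simp: init_seg_of_def chain_subset_def Chains_def)
  note R = Well_orderD[OF wo]
  show "Refl (\<Union>R)"
    using R(1) unfolding refl_on_def by fastforce
  show "trans (\<Union>R)"
    using chain_subset_trans_Union[OF sub] R(2) by simp
  show "antisym (\<Union>R)"
    using chain_subset_antisym_Union[OF sub] R(3) by simp
  show "Total (\<Union>R)"
    using chain_subset_Total_Union[OF sub] R(4) by simp
  have "\<Union>R - Id = \<Union>{r - Id | r. r \<in> R}" by blast
  moreover have "\<forall>s\<in>{r - Id | r. r \<in> R}. wf s"
    using R(5) by blast
  ultimately show "wf (\<Union>R - Id)"
    using wf_Union_wf_init_segs[OF Chains_inits_DiffI[OF chain]] by simp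
qed

lemma end_extension_new_after_old:
  assumes "(r, s) \<in> init_seg_of" "Refl r" "Total s" "x \<in> Field r" "y \<in> Field s" "y \<notin> Field r"
  shows "(x, y) \<in> s"
proof -
  have "x \<in> Field s"
    using assms(1,4) mono_Field[of r s] by (auto simp: init_seg_of_def)
  moreover have "(y, x) \<notin> s"
  proof
    assume "(y, x) \<in> s"
    moreover have "(x, x) \<in> r"
      using assms(2,4) by (simp add: refl_on_def)
    ultimately have "(y, x) \<in> r"
      using assms(1) unfolding init_seg_of_def by blast
    with assms(6) show False
      by (simp add: FieldI1)
  qed
  moreover have "x \<noteq> y"
    using assms(4,6) by auto
  ultimately show ?thesis
    using assms(3,5) unfolding total_on_def by blast
qed


section \<open>The run of the search\<close>

locale bfs_run =
  fixes V :: "'a set" and E L :: "'a rel"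
  assumes graph: "wellordered_connected_graph V E L"
    and nonempty: "V \<noteq> {}"
begin

abbreviation "B \<equiv> bfs_B V E L"
abbreviation "Q \<equiv> bfs_Q V E L"
abbreviation "q \<equiv> bfs_q V E L"
abbreviation "root \<equiv> least_elem L V"
abbreviation "\<Gamma> \<equiv> closure_ordinal V E L"
abbreviation "before \<equiv> bfs_ordering V E L"

definition active :: "'a ordinal \<Rightarrow> bool" where
  "active \<alpha> \<longleftrightarrow> Field (Q \<alpha>) - B \<alpha> \<noteq> {}"

lemmas active_step = bfs_osucc[of V E L, folded active_def]

lemma idle_step:
  assumes "\<not> active \<alpha>"
  shows "B (osucc \<alpha>) = B \<alpha>" "Q (osucc \<alpha>) = Q \<alpha>"
  using assms bfs_osucc_idle[of V E L \<alpha>] unfolding active_def by blast+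

lemma edges: "E \<subseteq> V \<times> V" "sym E"
  using graph by (auto simp: wellordered_connected_graph_def undirected_graph_def)

lemma connected: "induces_connected E V"
  using graph by (simp add: wellordered_connected_graph_def)

lemma vertex_order: "wellordering_on V L"
  using graph by (simp add: wellordered_connected_graph_def)

lemma root_in_V: "root \<in> V"
proof -
  have "total_on V L" "wf (L - Id)"
    using vertex_order by (auto simp: wellordering_on_def intro: wf_subset)
  then show ?thesis
    using least_elem_least(1)[OF antisym_wellordering_on[OF vertex_order]] nonempty by blast
qed

text \<open>
  The three assertions depend on each other: that appending keeps the queue well-ordered uses that its
  entries are vertices, and that limits keep it well-ordered uses the end-extensions.
\<close>

lemma queue_invariant:
  "Well_order (Q \<alpha>) \<and> Field (Q \<alpha>) \<subseteq> V \<and> (\<forall>\<beta>\<le>\<alpha>. (Q \<beta>, Q \<alpha>) \<in> init_seg_of)"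
proof (induction \<alpha> rule: ordinal_induct)
  case zero
  have "Well_order {(root, root)}"
    by (rule Well_orderI) (auto simp: refl_on_def trans_def antisym_def total_on_def Field_def)
  then show ?case
    using root_in_V by (auto simp: bfs_ozero Field_def antisym_conv)
next
  case (succ \<alpha>)
  show ?case
  proof (cases "active \<alpha>")
    case False
    then have "Q (osucc \<alpha>) = Q \<alpha>"
      by (rule idle_step(2))
    with succ show ?thesis
      by (metis less_osucc_iff order_le_less refl_on_init_seg_of)
  next
    case True
    let ?N = "neighbors E (q \<alpha>) - Field (Q \<alpha>)"
    have Q_succ: "Q (osucc \<alpha>) = append_in_order L (Q \<alpha>) ?N"
      using True by (rule active_step(2))
    have N: "?N \<subseteq> V" "?N \<inter> Field (Q \<alpha>) = {}"
      using edges(1) by (auto simp: neighbors_def)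
    have "Well_order (Q (osucc \<alpha>))"
      unfolding Q_succ using succ N vertex_order by (blast intro: Well_order_append_in_order)
    moreover have "Field (Q (osucc \<alpha>)) \<subseteq> V"
      using succ N(1) unfolding Q_succ Field_append_in_order by blast
    moreover have "(Q \<beta>, Q (osucc \<alpha>)) \<in> init_seg_of" if "\<beta> \<le> osucc \<alpha>" for \<beta>
    proof (cases "\<beta> = osucc \<alpha>")
      case False
      then have "(Q \<beta>, Q \<alpha>) \<in> init_seg_of"
        using that succ by (metis less_osucc_iff order_le_less)
      moreover have "(Q \<alpha>, Q (osucc \<alpha>)) \<in> init_seg_of"
        unfolding Q_succ using N(2) by (rule append_in_order_end_extends)
      ultimately show ?thesis
        by (rule trans_init_seg_of)
    qed simp
    ultimately show ?thesis by blast
  qed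
next
  case (limit \<alpha>)
  let ?R = "Q ` {..<\<alpha>}"
  have Q_limit: "Q \<alpha> = \<Union>?R"
    using bfs_limit(2)[OF limit(1)] .
  have chain: "?R \<in> Chains init_seg_of"
    unfolding Chains_def using limit(2) by (auto simp: image_iff) (metis linear)
  have "Well_order (Q \<alpha>)"
    unfolding Q_limit using limit(2) by (intro Well_order_Union_end_extensions[OF chain]) auto
  moreover have "Field (Q \<alpha>) \<subseteq> V"
    using limit(2) by (auto simp: Q_limit)
  moreover have "(Q \<beta>, Q \<alpha>) \<in> init_seg_of" if "\<beta> \<le> \<alpha>" for \<beta>
    using that Chains_init_seg_of_Union[OF chain, of "Q \<beta>"]
    by (cases "\<beta> = \<alpha>") (auto simp: Q_limit[symmetric])
  ultimately show ?case by blast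
qed

lemmas queue_well_order = Well_orderD[OF conjunct1[OF queue_invariant]]

lemma queue_end_extends: "\<beta> \<le> \<alpha> \<Longrightarrow> (Q \<beta>, Q \<alpha>) \<in> init_seg_of"
  using queue_invariant by blast

lemma queue_mono: "\<beta> \<le> \<alpha> \<Longrightarrow> Q \<beta> \<subseteq> Q \<alpha>"
  using queue_end_extends[of \<beta> \<alpha>] by (auto simp: init_seg_of_def)

lemma next_vertex_least:
  assumes "active \<alpha>"
  shows "q \<alpha> \<in> Field (Q \<alpha>) - B \<alpha>"
    and "\<And>y. y \<in> Field (Q \<alpha>) - B \<alpha> \<Longrightarrow> (q \<alpha>, y) \<in> Q \<alpha>"
proof -
  have "total_on (Field (Q \<alpha>) - B \<alpha>) (Q \<alpha>)"
    using queue_well_order(4) by (rule total_on_subset) auto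
  note least = least_elem_least[OF queue_well_order(3) this queue_well_order(5) assms[unfolded active_def],
      folded bfs_q_def]
  show q: "q \<alpha> \<in> Field (Q \<alpha>) - B \<alpha>"
    by (rule least(1))
  show "(q \<alpha>, y) \<in> Q \<alpha>" if "y \<in> Field (Q \<alpha>) - B \<alpha>" for y
    using least(2)[OF that] q queue_well_order(1)[of \<alpha>] by (auto simp: refl_on_def)
qed

text \<open>
  At a stage where the queue is exhausted, \<open>q \<beta>\<close> is an arbitrary value; such stages must be left out
  here and in the next lemma.
\<close>

lemma B_eq: "B \<alpha> = q ` {\<beta>. \<beta> < \<alpha> \<and> active \<beta>}"
proof (induction \<alpha> rule: ordinal_induct)
  case zero
  then show ?case by (simp add: bfs_ozero)
next
  case (succ \<alpha>)
  have split: "{\<beta>. \<beta> < osucc \<alpha> \<and> active \<beta>}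
      = {\<beta>. \<beta> < \<alpha> \<and> active \<beta>} \<union> {\<beta>. \<beta> = \<alpha> \<and> active \<beta>}"
    by (auto simp: less_osucc_iff)
  show ?case
  proof (cases "active \<alpha>")
    case True
    then have "{\<beta>. \<beta> = \<alpha> \<and> active \<beta>} = {\<alpha>}" by auto
    then show ?thesis
      unfolding split image_Un active_step(1)[OF True] succ[symmetric] by simp
  next
    case False
    then have none: "{\<beta>. \<beta> = \<alpha> \<and> active \<beta>} = {}" by auto
    show ?thesis
      unfolding split image_Un none idle_step(1)[OF False] succ[symmetric] by simp
  qed
next
  case (limit \<alpha>)
  have "B \<alpha> = (\<Union>\<gamma>\<in>{..<\<alpha>}. q ` {\<beta>. \<beta> < \<gamma> \<and> active \<beta>})"
    using limit(2) by (simp add: bfs_limit(1)[OF limit(1)])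
  also have "\<dots> = q ` (\<Union>\<gamma>\<in>{..<\<alpha>}. {\<beta>. \<beta> < \<gamma> \<and> active \<beta>})"
    by (rule image_UN[symmetric])
  finally show ?case
    unfolding stages_below_limit[OF limit(1)] .
qed

lemma Field_queue_eq:
  "Field (Q \<alpha>) = insert root (\<Union>\<beta>\<in>{\<beta>. \<beta> < \<alpha> \<and> active \<beta>}. neighbors E (q \<beta>))"
proof (induction \<alpha> rule: ordinal_induct)
  case zero
  then show ?case by (simp add: bfs_ozero)
next
  case (succ \<alpha>)
  have split: "{\<beta>. \<beta> < osucc \<alpha> \<and> active \<beta>}
      = {\<beta>. \<beta> < \<alpha> \<and> active \<beta>} \<union> {\<beta>. \<beta> = \<alpha> \<and> active \<beta>}"
    by (auto simp: less_osucc_iff)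
  show ?case
  proof (cases "active \<alpha>")
    case True
    then have "{\<beta>. \<beta> = \<alpha> \<and> active \<beta>} = {\<alpha>}" by auto
    moreover have "Field (Q (osucc \<alpha>)) = Field (Q \<alpha>) \<union> neighbors E (q \<alpha>)"
      unfolding active_step(2)[OF True] Field_append_in_order by blast
    ultimately show ?thesis
      unfolding split UN_Un succ by auto
  next
    case False
    then have none: "{\<beta>. \<beta> = \<alpha> \<and> active \<beta>} = {}" by auto
    show ?thesis
      unfolding split UN_Un none idle_step(2)[OF False] succ by simp
  qed
next
  case (limit \<alpha>)
  have "ozero < \<alpha>"
    using limit(1) by (metis is_limit_def ozero_le order_le_less)
  then have "{..<\<alpha>} \<noteq> {}" by blast
  have "Field (Q \<alpha>) = (\<Union>\<gamma>\<in>{..<\<alpha>}. Field (Q \<gamma>))"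
    by (simp add: bfs_limit(2)[OF limit(1)])
  also have "\<dots> = (\<Union>\<gamma>\<in>{..<\<alpha>}. insert root
      (\<Union>\<beta>\<in>{\<beta>. \<beta> < \<gamma> \<and> active \<beta>}. neighbors E (q \<beta>)))"
    using limit(2) by simp
  also have "\<dots> = insert root (\<Union>\<beta>\<in>(\<Union>\<gamma>\<in>{..<\<alpha>}. {\<beta>. \<beta> < \<gamma> \<and> active \<beta>}). neighbors E (q \<beta>))"
    using \<open>{..<\<alpha>} \<noteq> {}\<close> by blast
  finally show ?case unfolding stages_below_limit[OF limit(1)] .
qed

lemma B_mono: "\<beta> \<le> \<alpha> \<Longrightarrow> B \<beta> \<subseteq> B \<alpha>"
  unfolding B_eq by (intro image_mono) auto

lemma processed_distinct:
  assumes "\<beta> < \<alpha>" "active \<beta>" "active \<alpha>"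
  shows "q \<beta> \<noteq> q \<alpha>"
proof -
  have "q \<beta> \<in> B \<alpha>"
    unfolding B_eq using assms(1,2) by simp
  then show ?thesis
    using next_vertex_least(1)[OF assms(3)] by auto
qed

lemma idle_iff: "B \<alpha> = B (osucc \<alpha>) \<longleftrightarrow> \<not> active \<alpha>"
  using active_step(1)[of \<alpha>] idle_step(1)[of \<alpha>] next_vertex_least(1)[of \<alpha>]
  by blast

text \<open>
  If no stage were idle, \<open>q\<close> would be injective on all of \<open>'a ordinal\<close>, a type too large for that.
\<close>

lemma closure_ordinal_idle: "\<not> active \<Gamma>"
proof -
  have "\<exists>\<alpha>. \<not> active \<alpha>"
  proof (rule ccontr)
    assume "\<nexists>\<alpha>. \<not> active \<alpha>"
    then have neq: "q \<beta> \<noteq> q \<alpha>" if "\<beta> < \<alpha>" for \<alpha> \<beta>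
      using that processed_distinct by blast
    have "inj q"
      by (rule injI) (metis neq linorder_less_linear)
    then show False
      using no_inj_ordinal by blast
  qed
  then have "B \<Gamma> = B (osucc \<Gamma>)"
    unfolding closure_ordinal_def idle_iff[symmetric] by (rule LeastI_ex)
  then show ?thesis
    by (simp add: idle_iff)
qed

lemma active_below_closure: "\<alpha> < \<Gamma> \<Longrightarrow> active \<alpha>"
  using not_less_Least[of \<alpha> "\<lambda>\<alpha>. B \<alpha> = B (osucc \<alpha>)"] idle_iff
  unfolding closure_ordinal_def by blast

lemma queued_iff:
  assumes "\<alpha> \<le> \<Gamma>" "v \<noteq> root"
  shows "v \<in> Field (Q \<alpha>) \<longleftrightarrow> (\<exists>\<beta><\<alpha>. (q \<beta>, v) \<in> E)"
proof -
  have "{\<beta>. \<beta> < \<alpha> \<and> active \<beta>} = {..<\<alpha>}"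
    using active_below_closure assms(1) by (auto simp: order_less_le_trans)
  then show ?thesis
    unfolding Field_queue_eq using assms(2) by (auto simp: neighbors_def)
qed

lemma root_queued: "root \<in> Field (Q \<alpha>)"
  unfolding Field_queue_eq by blast

lemma q_queued: "\<alpha> < \<Gamma> \<Longrightarrow> \<alpha> \<le> \<beta> \<Longrightarrow> q \<alpha> \<in> Field (Q \<beta>)"
  using next_vertex_least(1)[OF active_below_closure] mono_Field[OF queue_mono] by blast

lemma B_closure: "B \<Gamma> = q ` {..<\<Gamma>}"
  unfolding B_eq using active_below_closure by auto

lemma Field_final_queue: "Field (Q \<Gamma>) = q ` {..<\<Gamma>}"
  using closure_ordinal_idle B_closure q_queued by (auto simp: active_def)

text \<open>
  Every entry of the final queue has been processed, so its neighbors are entries too; a set of vertices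
  that contains the root and is closed under neighbors is everything.
\<close>

lemma all_vertices_reached: "V = q ` {..<\<Gamma>}"
proof -
  have closed: "w \<in> Field (Q \<Gamma>)" if "v \<in> Field (Q \<Gamma>)" "(v, w) \<in> E" for v w
    using that queued_iff[of \<Gamma> w] root_queued[of \<Gamma>] unfolding Field_final_queue
    by (cases "w = root") auto
  have "v \<in> Field (Q \<Gamma>)" if "v \<in> V" for v
  proof -
    have "(root, v) \<in> (E \<inter> V \<times> V)\<^sup>*"
      using connected root_in_V that by (simp add: induces_connected_def)
    then show ?thesis
      by induction (use root_queued closed in auto)
  qed
  moreover have "Field (Q \<Gamma>) \<subseteq> V"
    using queue_invariant by blast
  ultimately show ?thesis
    using Field_final_queue by blast
qed


section \<open>The search order is the final queue\<close>

text \<open>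
  At stage \<open>\<alpha>\<close>, either \<open>q \<beta>\<close> already waits in the queue, behind the front entry \<open>q \<alpha>\<close>, or it joins
  later and thus behind everything present.
\<close>

lemma processed_in_queue_order:
  assumes "\<alpha> < \<beta>" "\<beta> < \<Gamma>"
  shows "(q \<alpha>, q \<beta>) \<in> Q \<Gamma>" "q \<alpha> \<noteq> q \<beta>"
proof -
  have act: "active \<alpha>" "active \<beta>"
    using assms active_below_closure order_less_trans by blast+
  have "\<alpha> \<le> \<Gamma>"
    using assms by simp
  show "q \<alpha> \<noteq> q \<beta>"
    using assms(1) act by (rule processed_distinct)
  have "q \<beta> \<notin> B \<alpha>"
    using next_vertex_least(1)[OF act(2)] B_mono[OF order_less_imp_le[OF assms(1)]] by blast
  show "(q \<alpha>, q \<beta>) \<in> Q \<Gamma>"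
  proof (cases "q \<beta> \<in> Field (Q \<alpha>)")
    case True
    then have "(q \<alpha>, q \<beta>) \<in> Q \<alpha>"
      using \<open>q \<beta> \<notin> B \<alpha>\<close> next_vertex_least(2)[OF act(1)] by blast
    then show ?thesis
      using queue_mono[OF \<open>\<alpha> \<le> \<Gamma>\<close>] by (rule subsetD[rotated])
  next
    case False
    have "q \<alpha> \<in> Field (Q \<alpha>)" "q \<beta> \<in> Field (Q \<Gamma>)"
      using q_queued assms by simp_all
    then show ?thesis
      using False end_extension_new_after_old[OF queue_end_extends[OF \<open>\<alpha> \<le> \<Gamma>\<close>] queue_well_order(1,4)]
      by blast
  qed
qed

lemma bfs_ordering_eq: "before = Q \<Gamma> - Id"
proof (intro equalityI subsetI)
  fix e assume "e \<in> before"
  then show "e \<in> Q \<Gamma> - Id"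
    using processed_in_queue_order by (auto simp: bfs_ordering_def)
next
  fix e assume e: "e \<in> Q \<Gamma> - Id"
  then have "fst e \<in> Field (Q \<Gamma>)" "snd e \<in> Field (Q \<Gamma>)"
    by (cases e; auto simp: Field_def)+
  then obtain \<alpha> \<beta> where ab: "e = (q \<alpha>, q \<beta>)" "\<alpha> < \<Gamma>" "\<beta> < \<Gamma>"
    unfolding Field_final_queue by (cases e) auto
  have "\<not> \<beta> < \<alpha>"
    using processed_in_queue_order(1)[of \<beta> \<alpha>] e ab antisymD[OF queue_well_order(3)] by auto
  moreover have "\<alpha> \<noteq> \<beta>"
    using e ab(1) by auto
  ultimately have "\<alpha> < \<beta>" by simp
  then show "e \<in> before"
    using ab by (auto simp: bfs_ordering_def)
qed

lemma final_queue_eq: "Field (Q \<Gamma>) = V"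
  using Field_final_queue all_vertices_reached by simp

lemma before_antisym: "antisym before"
  unfolding bfs_ordering_eq by (rule antisym_subset[OF Diff_subset queue_well_order(3)])

lemma wellordering_before: "wellordering_on V before"
  unfolding wellordering_on_def
proof (intro conjI)
  have "Q \<Gamma> \<subseteq> Field (Q \<Gamma>) \<times> Field (Q \<Gamma>)"
    by (auto simp: Field_def)
  then show "before \<subseteq> V \<times> V"
    unfolding bfs_ordering_eq final_queue_eq by (rule order_trans[OF Diff_subset])
  show "trans before"
    unfolding bfs_ordering_eq using queue_well_order(2,3) by (rule trans_diff_Id)
  show "total_on V before"
    using queue_well_order(4)[of \<Gamma>] unfolding bfs_ordering_eq final_queue_eq
    by (auto simp: total_on_def)
  show "wf before"
    unfolding bfs_ordering_eq by (rule queue_well_order(5))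
qed

lemma queued_earlier_before:
  assumes "\<alpha> \<le> \<Gamma>" "v \<in> Field (Q \<alpha>)" "w \<in> V" "w \<notin> Field (Q \<alpha>)"
  shows "(v, w) \<in> before"
  using end_extension_new_after_old[OF queue_end_extends[OF assms(1)] queue_well_order(1,4)] assms
  unfolding bfs_ordering_eq final_queue_eq by auto

lemma root_before:
  assumes "v \<in> V" "v \<noteq> root"
  shows "(root, v) \<in> before"
  using queued_earlier_before[of ozero root v] assms root_queued
  by (auto simp: bfs_ozero Field_def)

lemma least_elem_before: "least_elem before V = root"
  using before_antisym root_in_V root_before by (intro least_elem_eqI) auto

section \<open>Connected initial segments and monotone parents\<close>

text \<open>
  A vertex waits in the queue before it is processed, so the step that put it there, which is the
  processing of one of its neighbors, came earlier.
\<close>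

lemma smaller_neighbor:
  assumes "v \<in> V" "v \<noteq> root"
  obtains u where "(u, v) \<in> E" "(u, v) \<in> before"
proof -
  obtain \<alpha> where \<alpha>: "\<alpha> < \<Gamma>" "v = q \<alpha>"
    using assms(1) all_vertices_reached by auto
  then obtain \<beta> where "\<beta> < \<alpha>" "(q \<beta>, v) \<in> E"
    using queued_iff[of \<alpha> v] q_queued[of \<alpha> \<alpha>] assms(2) order_less_imp_le by blast
  with \<alpha> that show thesis
    by (auto simp: bfs_ordering_def)
qed

text \<open>
  Descending along smaller neighbors never leaves an initial segment, and by well-foundedness it ends
  at the root.
\<close>

lemma initial_segment_connected:
  assumes S: "initial_segment V before S"
  shows "induces_connected E S"
proof -
  let ?E = "E \<inter> S \<times> S"
  have wf: "wf before"
    using wellordering_before by (simp add: wellordering_on_def)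
  have to_root: "v \<in> S \<longrightarrow> (root, v) \<in> ?E\<^sup>*" for v
  proof (induction v rule: wf_induct_rule[OF wf, case_names less])
    case (less v)
    show ?case
    proof (cases "v = root \<or> v \<notin> S")
      case False
      then obtain u where u: "(u, v) \<in> E" "(u, v) \<in> before"
        using S smaller_neighbor[of v] unfolding initial_segment_def by blast
      then have "u \<in> S"
        using S False edges(1) unfolding initial_segment_def by blast
      then have "(u, v) \<in> ?E"
        using u(1) False by blast
      then show ?thesis
        using less[OF u(2)] \<open>u \<in> S\<close> by (blast intro: rtrancl_into_rtrancl)
    qed auto
  qed
  have "sym (?E\<^sup>*)"
    using edges(2) by (intro sym_rtrancl) (auto simp: sym_def)
  show ?thesis
    unfolding induces_connected_def
  proof (intro ballI)
    fix u v assume "u \<in> S" "v \<in> S"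
    then have "(u, root) \<in> ?E\<^sup>*" "(root, v) \<in> ?E\<^sup>*"
      using to_root \<open>sym (?E\<^sup>*)\<close> by (auto dest: symD)
    then show "(u, v) \<in> ?E\<^sup>*"
      by (rule rtrancl_trans)
  qed
qed

text \<open>
  Every neighbor of \<open>v\<close> is processed at some stage, and \<open>\<prec>\<close> compares stages; the least neighbor is
  therefore the first one processed.
\<close>

lemma least_neighbor_stage:
  assumes "v \<in> V" "v \<noteq> root"
  obtains \<alpha> where "\<alpha> < \<Gamma>" "least_neighbor E before v = q \<alpha>" "(q \<alpha>, v) \<in> E"
    "\<And>\<beta>. \<beta> < \<alpha> \<Longrightarrow> (q \<beta>, v) \<notin> E"
proof -
  have ex: "\<exists>\<alpha>. \<alpha> < \<Gamma> \<and> (q \<alpha>, v) \<in> E"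
    using assms queued_iff[of \<Gamma> v] final_queue_eq by auto
  define \<alpha> where "\<alpha> = (LEAST \<alpha>. \<alpha> < \<Gamma> \<and> (q \<alpha>, v) \<in> E)"
  have \<alpha>: "\<alpha> < \<Gamma>" "(q \<alpha>, v) \<in> E"
    using LeastI_ex[OF ex] by (auto simp: \<alpha>_def)
  have min: "(q \<beta>, v) \<notin> E" if "\<beta> < \<alpha>" for \<beta>
    using not_less_Least[OF that[unfolded \<alpha>_def]] that \<alpha>(1) by auto
  have "least_neighbor E before v = q \<alpha>"
    unfolding least_neighbor_def
  proof (rule least_elem_eqI[OF before_antisym])
    show "q \<alpha> \<in> neighbors E v"
      using \<alpha>(2) edges(2) by (auto simp: neighbors_def dest: symD)
    fix y assume "y \<in> neighbors E v"
    then have "(y, v) \<in> E"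
      using edges(2) by (auto simp: neighbors_def dest: symD)
    then obtain \<beta> where \<beta>: "\<beta> < \<Gamma>" "y = q \<beta>"
      using edges(1) all_vertices_reached by blast
    have "\<alpha> \<le> \<beta>"
      using min[of \<beta>] \<open>(y, v) \<in> E\<close> \<beta>(2) by (meson not_le)
    then show "q \<alpha> = y \<or> (q \<alpha>, y) \<in> before"
      using \<beta> by (cases "\<alpha> = \<beta>") (auto simp: bfs_ordering_def)
  qed
  with \<alpha> min that show thesis by blast
qed

text \<open>
  If the parent of \<open>w\<close> were processed before that of \<open>v\<close>, then right after its processing the queue
  would contain \<open>w\<close> but not yet \<open>v\<close>.
\<close>

lemma least_neighbor_mono:
  assumes v: "v \<in> V" "v \<noteq> root" and w: "w \<in> V" "w \<noteq> root" and le: "(v, w) \<in> before\<^sup>="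
  shows "(least_neighbor E before v, least_neighbor E before w) \<in> before\<^sup>="
proof -
  obtain \<alpha> where \<alpha>: "\<alpha> < \<Gamma>" "least_neighbor E before v = q \<alpha>"
    "\<And>\<beta>. \<beta> < \<alpha> \<Longrightarrow> (q \<beta>, v) \<notin> E"
    using least_neighbor_stage[OF v] by metis
  obtain \<beta> where \<beta>: "\<beta> < \<Gamma>" "least_neighbor E before w = q \<beta>" "(q \<beta>, w) \<in> E"
    using least_neighbor_stage[OF w] by metis
  have "\<not> \<beta> < \<alpha>"
  proof
    assume "\<beta> < \<alpha>"
    have "osucc \<beta> \<le> \<Gamma>"
      using \<beta>(1) by (simp add: osucc_le_iff)
    moreover have "w \<in> Field (Q (osucc \<beta>))"
      using queued_iff[OF \<open>osucc \<beta> \<le> \<Gamma>\<close> w(2)] \<beta>(3) less_osucc by blast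
    moreover have "v \<notin> Field (Q (osucc \<beta>))"
      using queued_iff[OF \<open>osucc \<beta> \<le> \<Gamma>\<close> v(2)] \<alpha>(3) \<open>\<beta> < \<alpha>\<close>
      by (meson less_osucc_iff order_le_less_trans)
    ultimately have "(w, v) \<in> before"
      using queued_earlier_before v(1) by blast
    then show False
      using le before_antisym bfs_ordering_eq by (auto dest: antisymD)
  qed
  then have "\<alpha> < \<beta> \<or> \<alpha> = \<beta>" by auto
  then show ?thesis
    using \<alpha>(2) \<beta>(1,2) by (auto simp: bfs_ordering_def)
qed

end

theorem proposition5p4:
  fixes V :: "'a set" and E L :: "'a rel"
  assumes "wellordered_connected_graph V E L"
    and "V \<noteq> {}"
  shows "breadth_first_traversal V E (bfs_ordering V E L)"
proof -
  interpret bfs_run V E L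
    using assms by unfold_locales
  show ?thesis
    unfolding breadth_first_traversal_def wellordered_traversal_def least_elem_before
    using wellordering_before initial_segment_connected least_neighbor_mono by simp
qed

end
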